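(* Let $q\ge 2$ and assume that quantum error-correcting codes $\mathcal{C}_1=(\!(n_1,K_1,d_1)\!)_q$ and $\mathcal{C}_2=(\!(n_2,K_2,d_2)\!)_q$ exist. Then a quantum error-correcting code $\mathcal{C}'=(\!(n_1+n_2,\,K_1K_2,\,\min\{d_1,d_2\})\!)_q$ exists as well.
   Context: The weight $\mathrm{wgt}(E)$ of a linear operator $E$ on $(\mathbb{C}^q)^{\otimes n}$ is the number of tensor factors (subsystems) on which it acts non-trivially, i.e. the smallest size of a set $T\subseteq\{1,\dots,n\}$ such that $E$ is the tensor product of the identity on the factors outside $T$ with some operator on the factors in $T$. A quantum error-correcting code $(\!(n,K,d)\!)_q$ is a complex linear subspace $\mathcal{C}\subseteq(\mathbb{C}^q)^{\otimes n}$ of dimension $K>1$ such that the Knill-Laflamme conditions hold for all pairs of linear operators $E_k,E_\ell$ on $(\mathbb{C}^q)^{\otimes n}$ with $\mathrm{wgt}(E_k^\dagger E_\ell)<d$: for an orthonormal basis $\{|c_i\rangle\}$ of $\mathcal{C}$, one has $\langle c_i|E_k^\dagger E_\ell|c_j\rangle=0$ for $i\neq j$, and $\langle c_i|E_k^\dagger E_\ell|c_i\rangle=\langle c_j|E_k^\dagger E_\ell|c_j\rangle$ for all $i,j$. Equivalently, $P_{\mathcal{C}}E_k^\dagger E_\ell P_{\mathcal{C}}=\alpha_{k\ell}P_{\mathcal{C}}$ for some scalar $\alpha_{k\ell}$, where $P_{\mathcal{C}}$ is the orthogonal projection onto $\mathcal{C}$. (So the parameter $d$ is a lower bound on the true minimum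 distance.) *)

theory Defs
  imports "Jordan_Normal_Form.Schur_Decomposition" "Jordan_Normal_Form.VS_Connect"
    "HOL-Library.FuncSet"
begin

text \<open>
  The space $(\mathbb{C}^q)^{\otimes n}$ is rendered as the space of complex vectors of
  dimension $q^n$: the index $i < q^n$ stands for the product basis vector
  $|x_0\rangle \otimes \dots \otimes |x_{n-1}\rangle$, where $x_k$ is the $k$-th base-$q$ digit
  of $i$. The tensor factors are numbered $0,\dots,n-1$, and linear operators are
  $q^n \times q^n$ matrices.
\<close>

definition qudit :: "nat \<Rightarrow> nat \<Rightarrow> nat \<Rightarrow> nat" where
  "qudit q i k = i div q ^ k mod q"

abbreviation state_space :: "nat \<Rightarrow> nat \<Rightarrow> (complex, complex vec) module" where
  "state_space q n \<equiv> module_vec TYPE(complex) (q ^ n)"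

abbreviation operators :: "nat \<Rightarrow> nat \<Rightarrow> complex mat set" where
  "operators q n \<equiv> carrier_mat (q ^ n) (q ^ n)"

text \<open>
  \<open>E\<close> is the tensor product of the identity on the factors outside \<open>T\<close> with an operator on the
  factors in \<open>T\<close>. The latter is given by its matrix entries \<open>A x y\<close>, where \<open>x\<close> and \<open>y\<close> range over
  the labels \<open>T \<rightarrow>\<^sub>E {..<q}\<close> of the product basis of these factors. The \<open>if\<close>
  expression is the matrix entry of the identity on the remaining factors.
\<close>

definition acts_only_on :: "nat \<Rightarrow> nat \<Rightarrow> nat set \<Rightarrow> complex mat \<Rightarrow> bool" where
  "acts_only_on q n T E \<longleftrightarrow>
     (\<exists>A :: (nat \<Rightarrow> nat) \<Rightarrow> (nat \<Rightarrow> nat) \<Rightarrow> complex. \<forall>i < q ^ n. \<forall>j < q ^ n.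
        E $$ (i, j) =
          (if \<forall>k \<in> {..<n} - T. qudit q i k = qudit q j k then 1 else 0)
          * A (restrict (qudit q i) T) (restrict (qudit q j) T))"

definition wgt :: "nat \<Rightarrow> nat \<Rightarrow> complex mat \<Rightarrow> nat" where
  "wgt q n E = (LEAST w. \<exists>T. T \<subseteq> {..<n} \<and> card T = w \<and> acts_only_on q n T E)"

text \<open>\<open>\<langle>u|v\<rangle>\<close>: the library's \<open>\<bullet>c\<close> conjugates its second argument, hence the swap.\<close>

definition braket :: "complex vec \<Rightarrow> complex vec \<Rightarrow> complex" where
  "braket u v = v \<bullet>c u"

definition orthonormal_basis :: "nat \<Rightarrow> nat \<Rightarrow> complex vec set \<Rightarrow> complex vec set \<Rightarrow> bool" where
  "orthonormal_basis q n C B \<longleftrightarrow>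
     vectorspace.basis class_ring (state_space q n\<lparr>carrier := C\<rparr>) B
     \<and> (\<forall>u \<in> B. \<forall>v \<in> B. braket u v = (if u = v then 1 else 0))"

definition knill_laflamme :: "nat \<Rightarrow> nat \<Rightarrow> nat \<Rightarrow> complex vec set \<Rightarrow> bool" where
  "knill_laflamme q n d B \<longleftrightarrow>
     (\<forall>E \<in> operators q n. \<forall>F \<in> operators q n. wgt q n (mat_adjoint E * F) < d \<longrightarrow>
        (\<forall>u \<in> B. \<forall>v \<in> B. u \<noteq> v \<longrightarrow> braket u (mat_adjoint E * F *\<^sub>v v) = 0)
        \<and> (\<forall>u \<in> B. \<forall>v \<in> B.
             braket u (mat_adjoint E * F *\<^sub>v u) = braket v (mat_adjoint E * F *\<^sub>v v)))"

text \<open>\<open>C\<close> is an $(\!(n,K,d)\!)_q$ code; \<open>d\<close> is only a lower bound on the minimum distance.\<close>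

definition quantum_code :: "nat \<Rightarrow> nat \<Rightarrow> nat \<Rightarrow> nat \<Rightarrow> complex vec set \<Rightarrow> bool" where
  "quantum_code q n K d C \<longleftrightarrow>
     VectorSpace.subspace class_ring C (state_space q n)
     \<and> vectorspace.dim class_ring (state_space q n\<lparr>carrier := C\<rparr>) = K
     \<and> K > 1
     \<and> (\<exists>B. orthonormal_basis q n C B \<and> knill_laflamme q n d B)"

text \<open>
  The set of weights in \<open>wgt\<close> is never empty, so the \<open>LEAST\<close> there is a genuine minimum.
\<close>

lemma qudits_eq_imp_eq:
  assumes "i < q ^ n" "j < q ^ n" "\<And>k. k < n \<Longrightarrow> qudit q i k = qudit q j k"
  shows "i = j"
  using assms
proof (induction n arbitrary: i j)
  case (Suc n)
  have "i div q = j div q"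
  proof (rule Suc.IH)
    show "i div q < q ^ n" "j div q < q ^ n"
      using Suc.prems(1,2) by (auto simp: less_mult_imp_div_less mult.commute)
    fix k assume "k < n"
    then show "qudit q (i div q) k = qudit q (j div q) k"
      using Suc.prems(3)[of "Suc k"] by (simp add: qudit_def div_mult2_eq)
  qed
  moreover have "i mod q = j mod q"
    using Suc.prems(3)[of 0] by (simp add: qudit_def)
  ultimately show ?case by (metis div_mult_mod_eq)
qed simp

lemma acts_only_on_all: "acts_only_on q n {..<n} E"
proof -
  define dec where "dec x = (THE i. i < q ^ n \<and> restrict (qudit q i) {..<n} = x)" for x
  have dec: "dec (restrict (qudit q i) {..<n}) = i" if "i < q ^ n" for i
    unfolding dec_def
  proof (rule the_equality)
    fix j assume j: "j < q ^ n \<and> restrict (qudit q j) {..<n} = restrict (qudit q i) {..<n}"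
    show "j = i"
    proof (rule qudits_eq_imp_eq)
      fix k assume "k < n"
      then show "qudit q j k = qudit q i k"
        using j by (metis lessThan_iff restrict_apply')
    qed (use that j in auto)
  qed (use that in auto)
  show ?thesis unfolding acts_only_on_def
    by (rule exI[of _ "\<lambda>x y. E $$ (dec x, dec y)"]) (simp add: dec)
qed

lemma wgt_le: "wgt q n E \<le> n"
  unfolding wgt_def by (rule Least_le) (use acts_only_on_all in \<open>auto intro!: exI[of _ "{..<n}"]\<close>)

end

(* The code is the tensor product of the two codes, spanned by the products u \<otimes> v of orthonormal
   basis vectors. Suppose that M acts on fewer than min d1 d2 factors. For fixed v and v', the
   contraction (I \<otimes> \<langle>v|) M (I \<otimes> |v'\<rangle>) acts only on those factors of M that belong to the
   first code, so the Knill-Laflamme condition of the first code makes the matrix element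
   \<langle>u \<otimes> v| M |u' \<otimes> v'\<rangle> vanish for u \<noteq> u' and independent of u for u = u'. Contracting with
   u and u' gives the same for v and v', and so the matrix elements form a scalar matrix. *)

theory Submission
  imports Defs
begin

section \<open>Matrix elements, weights and the Knill-Laflamme conditions\<close>

lemma braket_eq_sum:
  assumes "u \<in> carrier_vec N" "v \<in> carrier_vec N"
  shows "braket u v = (\<Sum>i<N. cnj (u $ i) * v $ i)"
  using assms
  by (simp add: braket_def scalar_prod_def lessThan_atLeast0 mult.commute conjugate_complex_def)

lemma braket_mult_mat_vec:
  assumes "u \<in> carrier_vec N" "v \<in> carrier_vec N" "M \<in> carrier_mat N N"
  shows "braket u (M *\<^sub>v v) = (\<Sum>i<N. \<Sum>j<N. cnj (u $ i) * M $$ (i, j) * v $ j)"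
proof -
  have "(M *\<^sub>v v) $ i = (\<Sum>j<N. M $$ (i, j) * v $ j)" if "i < N" for i
    using that assms by (simp add: scalar_prod_def lessThan_atLeast0)
  then show ?thesis
    using assms
    by (simp add: braket_eq_sum[OF assms(1) mult_mat_vec_carrier[OF assms(3,2)]]
        sum_distrib_left mult.assoc)
qed

lemma mat_adjoint_mult_carrier:
  assumes "E \<in> carrier_mat N N" "F \<in> carrier_mat N N"
  shows "mat_adjoint E * F \<in> carrier_mat N N"
  using assms by (auto simp: mat_adjoint_def)

lemma mat_adjoint_one: "mat_adjoint (1\<^sub>m N) = (1\<^sub>m N :: complex mat)"
  by (rule eq_matI) (auto simp: mat_adjoint_def mat_of_rows_def)

text \<open>The minimum in \<open>wgt\<close> is attained, since the set of all factors is always a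
  support.\<close>

lemma wgt_witness:
  obtains T where "T \<subseteq> {..<n}" "card T = wgt q n E" "acts_only_on q n T E"
proof -
  have "\<exists>w T. T \<subseteq> {..<n} \<and> card T = w \<and> acts_only_on q n T E"
    using acts_only_on_all by blast
  from LeastI_ex[OF this] show thesis
    unfolding wgt_def[symmetric] by (blast intro: that)
qed

lemma wgt_le_card:
  assumes "T \<subseteq> {..<n}" "acts_only_on q n T E"
  shows "wgt q n E \<le> card T"
  unfolding wgt_def by (rule Least_le) (use assms in blast)

text \<open>Taking \<open>E\<close> to be the identity turns any operator \<open>M\<close> into a
  product \<open>mat_adjoint E * F\<close>, and the weight is below \<open>d\<close> exactly when
  some support \<open>T\<close> has fewer than \<open>d\<close> elements. Supports are easy to
  follow through a contraction, whereas the exact weight is not. The single scalar \<open>c\<close>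
  matches the projector form of the conditions.\<close>

lemma knill_laflamme_iff:
  assumes B: "B \<subseteq> carrier_vec (q ^ n)"
  shows "knill_laflamme q n d B \<longleftrightarrow>
    (\<forall>M \<in> operators q n. \<forall>T \<subseteq> {..<n}. card T < d \<longrightarrow> acts_only_on q n T M \<longrightarrow>
      (\<exists>c. \<forall>u \<in> B. \<forall>v \<in> B. braket u (M *\<^sub>v v) = (if u = v then c else 0)))"
    (is "_ \<longleftrightarrow> ?R")
proof
  assume KL: "knill_laflamme q n d B"
  show ?R
  proof (intro ballI allI impI)
    fix M T
    assume M: "M \<in> operators q n" and T: "T \<subseteq> {..<n}" "card T < d" "acts_only_on q n T M"
    have "mat_adjoint (1\<^sub>m (q ^ n)) * M = M"
      using M by (simp add: mat_adjoint_one)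
    moreover have "wgt q n M < d"
      using wgt_le_card[OF T(1,3)] T(2) by simp
    ultimately have *:
      "(\<forall>u \<in> B. \<forall>v \<in> B. u \<noteq> v \<longrightarrow> braket u (M *\<^sub>v v) = 0) \<and>
       (\<forall>u \<in> B. \<forall>v \<in> B. braket u (M *\<^sub>v u) = braket v (M *\<^sub>v v))"
      using KL M unfolding knill_laflamme_def by (metis one_carrier_mat)
    show "\<exists>c. \<forall>u \<in> B. \<forall>v \<in> B. braket u (M *\<^sub>v v) = (if u = v then c else 0)"
    proof (cases "B = {}")
      \<comment> \<open>The diagonal value at an arbitrary basis vector serves as the
        constant.\<close>
      case False
      then obtain w where "w \<in> B" by blast
      with * have "\<forall>u \<in> B. \<forall>v \<in> B.
          braket u (M *\<^sub>v v) = (if u = v then braket w (M *\<^sub>v w) else 0)"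
        by (metis (full_types))
      then show ?thesis ..
    qed simp
  qed
next
  assume R: ?R
  show "knill_laflamme q n d B"
    unfolding knill_laflamme_def
  proof (intro ballI impI)
    fix E F
    assume EF: "E \<in> operators q n" "F \<in> operators q n" "wgt q n (mat_adjoint E * F) < d"
    obtain T where "T \<subseteq> {..<n}" "card T < d" "acts_only_on q n T (mat_adjoint E * F)"
      using wgt_witness EF(3) by metis
    then have "\<exists>c. \<forall>u \<in> B. \<forall>v \<in> B.
        braket u (mat_adjoint E * F *\<^sub>v v) = (if u = v then c else 0)"
      using R mat_adjoint_mult_carrier[OF EF(1,2)] by blast
    then show "(\<forall>u \<in> B. \<forall>v \<in> B. u \<noteq> v \<longrightarrow> braket u (mat_adjoint E * F *\<^sub>v v) = 0)
        \<and> (\<forall>u \<in> B. \<forall>v \<in> B.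
             braket u (mat_adjoint E * F *\<^sub>v u) = braket v (mat_adjoint E * F *\<^sub>v v))"
      by auto
  qed
qed

section \<open>Passing between codes and their orthonormal bases\<close>

text \<open>A basis in the sense of the library may be infinite; here finiteness comes from linear
  independence in the finite-dimensional ambient space, and only then does the cardinality give the
  dimension.\<close>

lemma orthonormal_basisD:
  assumes C: "VectorSpace.subspace class_ring C (state_space q n)"
    and B: "orthonormal_basis q n C B"
  shows "B \<subseteq> carrier_vec (q ^ n)" "finite B"
    "vectorspace.dim class_ring (state_space q n\<lparr>carrier := C\<rparr>) = card B"
proof -
  interpret vec_space "TYPE(complex)" "q ^ n" .
  interpret W: vectorspace class_ring "state_space q n\<lparr>carrier := C\<rparr>"
    using C by (rule subspace_is_vs)
  have sub: "submodule class_ring C (state_space q n)"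
    using C by (rule is_module)
  have basis: "W.basis B"
    using B by (simp add: orthonormal_basis_def)
  then have "B \<subseteq> C"
    by (simp add: W.basis_def)
  then show "B \<subseteq> carrier_vec (q ^ n)"
    using submodule.subset[OF sub] by simp
  \<comment> \<open>Linear independence means the same in the subspace and in the ambient
    space.\<close>
  moreover have "lin_indpt B"
    using basis span_li_not_depend(2)[OF \<open>B \<subseteq> C\<close> sub] by (simp add: W.basis_def)
  ultimately show "finite B"
    using fin_dim_li_fin by simp
  then show "W.dim = card B"
    using W.dim_basis basis by simp
qed

text \<open>Orthonormal vectors are linearly independent, so they form a basis of their span. This
  lets the product code be specified by its basis vectors alone.\<close>

lemma orthonormal_basis_span:
  assumes B: "B \<subseteq> carrier_vec (q ^ n)" "finite B"
    and ortho: "\<forall>u \<in> B. \<forall>v \<in> B. braket u v = (if u = v then 1 else 0)"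
  obtains C where "VectorSpace.subspace class_ring C (state_space q n)"
    "orthonormal_basis q n C B"
proof -
  interpret vec_space "TYPE(complex)" "q ^ n" .
  have indpt: "lin_indpt B"
  proof (rule finite_lin_indpt2)
    fix a :: "complex vec \<Rightarrow> complex"
    assume 0: "lincomb a B = 0\<^sub>v (q ^ n)"
    show "\<forall>v\<in>B. a v = 0"
    proof
      fix v assume v: "v \<in> B"
      \<comment> \<open>Pairing the linear relation with \<open>v\<close> isolates the coefficient
        of \<open>v\<close>.\<close>
      have "0 = (\<Sum>i<q ^ n. cnj (v $ i) * lincomb a B $ i)"
        using 0 by simp
      also have "\<dots> = (\<Sum>i<q ^ n. \<Sum>u\<in>B. cnj (v $ i) * (a u * u $ i))"
        using lincomb_index[OF _ B(1)] by (simp add: sum_distrib_left)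
      also have "\<dots> = (\<Sum>u\<in>B. a u * (\<Sum>i<q ^ n. cnj (v $ i) * u $ i))"
        by (subst sum.swap) (simp add: sum_distrib_left mult.left_commute)
      also have "\<dots> = (\<Sum>u\<in>B. a u * braket v u)"
        using B v by (intro sum.cong refl) (metis braket_eq_sum subsetD)
      also have "\<dots> = (\<Sum>u\<in>B. if u = v then a u else 0)"
        using ortho v by (intro sum.cong) auto
      also have "\<dots> = a v"
        using B v by simp
      finally show "a v = 0" by simp
    qed
  qed (use B in auto)
  have C: "VectorSpace.subspace class_ring (span B) (state_space q n)"
    using B span_is_subspace by simp
  interpret W: vectorspace class_ring "state_space q n\<lparr>carrier := span B\<rparr>"
    using C by (rule subspace_is_vs)
  have sub: "submodule class_ring (span B) (state_space q n)"
    using C by (rule is_module)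
  have BC: "B \<subseteq> span B"
    using B in_own_span by simp
  have "W.basis B"
    using span_li_not_depend[OF BC sub] indpt BC by (simp add: W.basis_def)
  then have "orthonormal_basis q n (span B) B"
    using ortho by (simp add: orthonormal_basis_def)
  then show thesis
    using that C by blast
qed

section \<open>Tensor products of vectors\<close>

text \<open>The first factor gets the low digits because \<open>qudit\<close> numbers digits from the least significant one.\<close>

definition tensor_vec :: "complex vec \<Rightarrow> complex vec \<Rightarrow> complex vec" where
  "tensor_vec u v = vec (dim_vec u * dim_vec v) (\<lambda>i. u $ (i mod dim_vec u) * v $ (i div dim_vec u))"

lemma add_mult_less:
  fixes a c m k :: nat
  assumes "a < m" "c < k"
  shows "a + m * c < m * k"
proof -
  have "a + m * c < m * Suc c" using assms by simp
  also have "\<dots> \<le> m * k" using assms by (intro mult_le_mono2) simp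
  finally show ?thesis .
qed

lemma tensor_vec_carrier:
  assumes "u \<in> carrier_vec m" "v \<in> carrier_vec k"
  shows "tensor_vec u v \<in> carrier_vec (m * k)"
  using assms by (auto simp: tensor_vec_def)

lemma tensor_vec_index:
  assumes "u \<in> carrier_vec m" "v \<in> carrier_vec k" "a < m" "c < k"
  shows "tensor_vec u v $ (a + m * c) = u $ a * v $ c"
  using assms add_mult_less[OF assms(3,4)] by (auto simp: tensor_vec_def)

text \<open>Division with remainder by \<open>m\<close> splits a joint index into the index of the
  first factor (remainder) and that of the second (quotient).\<close>

lemma sum_lessThan_mult:
  fixes f :: "nat \<Rightarrow> 'a :: comm_monoid_add"
  shows "(\<Sum>i<m * k. f i) = (\<Sum>a<m. \<Sum>c<k. f (a + m * c))"
proof -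
  have "(\<Sum>i<m * k. f i) = (\<Sum>(a, c)\<in>{..<m} \<times> {..<k}. f (a + m * c))"
    \<comment> \<open>An index below \<open>m * k\<close> can exist only if \<open>m > 0\<close>, so
      its remainder is below \<open>m\<close>.\<close>
    by (rule sum.reindex_bij_witness[of _ "\<lambda>(a, c). a + m * c" "\<lambda>i. (i mod m, i div m)"])
       (auto simp: add_mult_less less_mult_imp_div_less mult.commute[of k m] intro!: mod_less_divisor intro: gr0I)
  then show ?thesis
    by (simp add: sum.cartesian_product)
qed

lemma braket_tensor_vec:
  assumes "u \<in> carrier_vec m" "u' \<in> carrier_vec m" "v \<in> carrier_vec k" "v' \<in> carrier_vec k"
  shows "braket (tensor_vec u v) (tensor_vec u' v') = braket u u' * braket v v'"
  using assms
  by (simp add: braket_eq_sum[of _ "m * k"] braket_eq_sum[of _ m] braket_eq_sum[of _ k]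
      tensor_vec_carrier sum_lessThan_mult tensor_vec_index sum_product mult.assoc mult.left_commute)

section \<open>Contracting an operator with vectors of one factor\<close>

text \<open>The operators \<open>(I \<otimes> \<langle>v|) M (I \<otimes> |v'\<rangle>)\<close> and \<open>(\<langle>u| \<otimes> I) M (|u'\<rangle> \<otimes> I)\<close>.\<close>

definition contract_snd :: "nat \<Rightarrow> nat \<Rightarrow> complex vec \<Rightarrow> complex mat \<Rightarrow> complex vec \<Rightarrow> complex mat" where
  "contract_snd m k v M v' = mat m m (\<lambda>(a, b).
     \<Sum>c<k. \<Sum>d<k. cnj (v $ c) * M $$ (a + m * c, b + m * d) * v' $ d)"

definition contract_fst :: "nat \<Rightarrow> nat \<Rightarrow> complex vec \<Rightarrow> complex mat \<Rightarrow> complex vec \<Rightarrow> complex mat" where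
  "contract_fst m k u M u' = mat k k (\<lambda>(c, d).
     \<Sum>a<m. \<Sum>b<m. cnj (u $ a) * M $$ (a + m * c, b + m * d) * u' $ b)"

lemma contract_carrier:
  "contract_snd m k v M v' \<in> carrier_mat m m" "contract_fst m k u M u' \<in> carrier_mat k k"
  by (simp_all add: contract_snd_def contract_fst_def)

text \<open>This expanded sum is the common form in which both contractions are compared with
  \<open>M\<close>.\<close>

lemma braket_tensor_vec_mult:
  assumes u: "u \<in> carrier_vec m" "u' \<in> carrier_vec m"
    and v: "v \<in> carrier_vec k" "v' \<in> carrier_vec k"
    and M: "M \<in> carrier_mat (m * k) (m * k)"
  shows "braket (tensor_vec u v) (M *\<^sub>v tensor_vec u' v') =
      (\<Sum>a<m. \<Sum>c<k. \<Sum>b<m. \<Sum>d<k.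
        cnj (u $ a) * cnj (v $ c) * M $$ (a + m * c, b + m * d) * u' $ b * v' $ d)"
  using u v
  by (simp add: braket_mult_mat_vec[OF tensor_vec_carrier tensor_vec_carrier M] sum_lessThan_mult
      tensor_vec_index mult.assoc)

text \<open>Both sides are the same fourfold sum in different orders. This is how a condition on
  operators of the first factor reaches matrix elements of \<open>M\<close>.\<close>

lemma braket_contract_snd:
  assumes "u \<in> carrier_vec m" "u' \<in> carrier_vec m" "v \<in> carrier_vec k" "v' \<in> carrier_vec k"
    and "M \<in> carrier_mat (m * k) (m * k)"
  shows "braket u (contract_snd m k v M v' *\<^sub>v u') =
    braket (tensor_vec u v) (M *\<^sub>v tensor_vec u' v')"
proof -
  have "braket u (contract_snd m k v M v' *\<^sub>v u') = (\<Sum>a<m. \<Sum>b<m. \<Sum>c<k. \<Sum>d<k.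
        cnj (u $ a) * cnj (v $ c) * M $$ (a + m * c, b + m * d) * u' $ b * v' $ d)"
    by (simp add: braket_mult_mat_vec[OF assms(1,2) contract_carrier(1)])
       (simp add: contract_snd_def sum_distrib_left sum_distrib_right mult_ac)
  also have "\<dots> = braket (tensor_vec u v) (M *\<^sub>v tensor_vec u' v')"
    unfolding braket_tensor_vec_mult[OF assms] by (intro sum.cong refl sum.swap)
  finally show ?thesis .
qed

lemma braket_contract_fst:
  assumes "u \<in> carrier_vec m" "u' \<in> carrier_vec m" "v \<in> carrier_vec k" "v' \<in> carrier_vec k"
    and "M \<in> carrier_mat (m * k) (m * k)"
  shows "braket v (contract_fst m k u M u' *\<^sub>v v') =
    braket (tensor_vec u v) (M *\<^sub>v tensor_vec u' v')"
proof -
  let ?f = "\<lambda>a b c d. cnj (u $ a) * cnj (v $ c) * M $$ (a + m * c, b + m * d) * u' $ b * v' $ d"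
  have "braket v (contract_fst m k u M u' *\<^sub>v v') = (\<Sum>c<k. \<Sum>d<k. \<Sum>a<m. \<Sum>b<m. ?f a b c d)"
    by (simp add: braket_mult_mat_vec[OF assms(3,4) contract_carrier(2)])
       (simp add: contract_fst_def sum_distrib_left sum_distrib_right mult_ac)
  \<comment> \<open>Three swaps of neighbouring sums lead from the order \<open>c d a b\<close> to
    \<open>a c b d\<close>.\<close>
  also have "\<dots> = (\<Sum>c<k. \<Sum>a<m. \<Sum>d<k. \<Sum>b<m. ?f a b c d)"
    by (intro sum.cong refl sum.swap)
  also have "\<dots> = (\<Sum>a<m. \<Sum>c<k. \<Sum>d<k. \<Sum>b<m. ?f a b c d)"
    by (rule sum.swap)
  also have "\<dots> = (\<Sum>a<m. \<Sum>c<k. \<Sum>b<m. \<Sum>d<k. ?f a b c d)"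
    by (intro sum.cong refl sum.swap)
  also have "\<dots> = braket (tensor_vec u v) (M *\<^sub>v tensor_vec u' v')"
    unfolding braket_tensor_vec_mult[OF assms] ..
  finally show ?thesis .
qed

section \<open>Supports of operators under concatenation and contraction\<close>

text \<open>For \<open>k < m\<close> the number \<open>q ^ m * c\<close> is a multiple of
  \<open>q ^ Suc k\<close> and cannot affect digit \<open>k\<close>. For \<open>k \<ge> m\<close>,
  dividing by \<open>q ^ m\<close> first discards \<open>a\<close> and leaves
  \<open>c\<close>.\<close>

lemma qudit_concat:
  assumes "a < q ^ m"
  shows "qudit q (a + q ^ m * c) k = (if k < m then qudit q a k else qudit q c (k - m))"
proof (cases "k < m")
  case True
  \<comment> \<open>Since \<open>m > 0\<close> here, \<open>q = 0\<close> would give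
    \<open>q ^ m = 0\<close> and leave no room for \<open>a\<close>.\<close>
  have q: "q ^ k > 0"
    using assms True by (metis gr0I power_eq_0_iff less_nat_zero_code neq0_conv)
  have "q ^ m = q ^ (k + Suc (m - Suc k))"
    using True by simp
  then have "q ^ m = q ^ k * (q * q ^ (m - Suc k))"
    by (simp only: power_add power_Suc)
  then have split: "q ^ m * c = q ^ k * (q * (q ^ (m - Suc k) * c))"
    by (simp only: mult.assoc)
  have "(a + q ^ m * c) div q ^ k = a div q ^ k + q * (q ^ (m - Suc k) * c)"
    unfolding split using q by (subst div_mult_self2) auto
  with True show ?thesis
    by (simp add: qudit_def)
next
  case False
  have "q ^ k = q ^ m * q ^ (k - m)"
    using False by (simp flip: power_add)
  moreover have "(a + q ^ m * c) div q ^ m = c"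
    using assms by (metis add_0_right div_less div_mult_self2 less_nat_zero_code)
  ultimately show ?thesis
    using False by (simp add: qudit_def div_mult2_eq)
qed

text \<open>This is the matrix entry of the identity on the factors in \<open>S\<close>; the name
  keeps the conditional a single factor in the algebra of sums.\<close>

definition id_entry :: "nat \<Rightarrow> nat set \<Rightarrow> nat \<Rightarrow> nat \<Rightarrow> complex" where
  "id_entry q S i j = (if \<forall>k \<in> S. qudit q i k = qudit q j k then 1 else 0)"

text \<open>Off \<open>T\<close>, agreement of all digits means agreement in each block separately,
  so the identity part factorizes. The part on \<open>T\<close> need not factorize; it merely
  depends on the labels of \<open>T1\<close> and of \<open>T2\<close>, the latter shifted down by
  \<open>n1\<close>.\<close>

lemma acts_only_on_concat:
  assumes T: "T \<subseteq> {..<n1 + n2}" and M: "acts_only_on q (n1 + n2) T M"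
  defines "T1 \<equiv> T \<inter> {..<n1}" and "T2 \<equiv> {k. n1 + k \<in> T}"
  shows "\<exists>A. \<forall>a < q ^ n1. \<forall>b < q ^ n1. \<forall>c < q ^ n2. \<forall>d < q ^ n2.
    M $$ (a + q ^ n1 * c, b + q ^ n1 * d) =
      id_entry q ({..<n1} - T1) a b * id_entry q ({..<n2} - T2) c d
      * A (restrict (qudit q a) T1) (restrict (qudit q b) T1)
          (restrict (qudit q c) T2) (restrict (qudit q d) T2)"
proof -
  obtain A where A: "\<forall>i < q ^ (n1 + n2). \<forall>j < q ^ (n1 + n2). M $$ (i, j) =
      (if \<forall>k \<in> {..<n1 + n2} - T. qudit q i k = qudit q j k then 1 else 0)
      * A (restrict (qudit q i) T) (restrict (qudit q j) T)"
    using M unfolding acts_only_on_def by blast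
  \<comment> \<open>Labels on \<open>T1\<close> and \<open>T2\<close> are joined to a label on
    \<open>T\<close>. For \<open>k\<close> in \<open>T\<close> only values inside \<open>T1\<close>
    or \<open>T2\<close> are read, so the default values of \<open>restrict\<close> never
    enter.\<close>
  define glue where "glue x y = (\<lambda>k\<in>T. if k < n1 then x k else y (k - n1))"
    for x y :: "nat \<Rightarrow> nat"
  have restrict_glue: "restrict (qudit q (a + q ^ n1 * c)) T =
      glue (restrict (qudit q a) T1) (restrict (qudit q c) T2)" if "a < q ^ n1" for a c
    using that by (auto simp: glue_def qudit_concat T1_def T2_def fun_eq_iff restrict_def)
  have off: "(\<forall>k \<in> {..<n1 + n2} - T. qudit q (a + q ^ n1 * c) k = qudit q (b + q ^ n1 * d) k)
      \<longleftrightarrow> (\<forall>k \<in> {..<n1} - T1. qudit q a k = qudit q b k)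
        \<and> (\<forall>k \<in> {..<n2} - T2. qudit q c k = qudit q d k)" (is "?l \<longleftrightarrow> ?r1 \<and> ?r2")
    if "a < q ^ n1" "b < q ^ n1" for a b c d
  proof
    assume l: ?l
    show "?r1 \<and> ?r2"
    proof (intro conjI ballI)
      fix k assume "k \<in> {..<n1} - T1"
      then show "qudit q a k = qudit q b k"
        using l[rule_format, of k] that by (auto simp: qudit_concat T1_def)
    next
      fix k assume "k \<in> {..<n2} - T2"
      then show "qudit q c k = qudit q d k"
        using l[rule_format, of "n1 + k"] that by (auto simp: qudit_concat T2_def)
    qed
  next
    assume r: "?r1 \<and> ?r2"
    show ?l
    proof
      fix k assume k: "k \<in> {..<n1 + n2} - T"
      show "qudit q (a + q ^ n1 * c) k = qudit q (b + q ^ n1 * d) k"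
      proof (cases "k < n1")
        case True
        then show ?thesis using r k that by (auto simp: qudit_concat T1_def)
      next
        case False
        then have "k - n1 \<in> {..<n2} - T2" using k by (auto simp: T2_def)
        then show ?thesis using r that False by (auto simp: qudit_concat)
      qed
    qed
  qed
  show ?thesis
  proof (rule exI[of _ "\<lambda>x x' y y'. A (glue x y) (glue x' y')"], intro allI impI)
    fix a b c d assume ab: "a < q ^ n1" "b < q ^ n1" and cd: "c < q ^ n2" "d < q ^ n2"
    have "a + q ^ n1 * c < q ^ (n1 + n2)" "b + q ^ n1 * d < q ^ (n1 + n2)"
      using ab cd by (simp_all add: power_add add_mult_less)
    then show "M $$ (a + q ^ n1 * c, b + q ^ n1 * d) =
      id_entry q ({..<n1} - T1) a b * id_entry q ({..<n2} - T2) c d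
      * A (glue (restrict (qudit q a) T1) (restrict (qudit q c) T2))
          (glue (restrict (qudit q b) T1) (restrict (qudit q d) T2))"
      using A by (simp add: off[OF ab] restrict_glue ab id_entry_def)
  qed
qed

text \<open>The identity part on the first block does not involve the summation indices
  \<open>c\<close> and \<open>d\<close> and can be pulled out of the sum. What remains depends on
  the outer indices only through their labels on \<open>T\<close>.\<close>

lemma acts_only_on_contract_snd:
  assumes "T \<subseteq> {..<n1 + n2}" "acts_only_on q (n1 + n2) T M"
  shows "acts_only_on q n1 (T \<inter> {..<n1}) (contract_snd (q ^ n1) (q ^ n2) v M v')"
proof -
  let ?T1 = "T \<inter> {..<n1}" and ?T2 = "{k. n1 + k \<in> T}"
  let ?\<delta>1 = "id_entry q ({..<n1} - ?T1)" and ?\<delta>2 = "id_entry q ({..<n2} - ?T2)"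
  obtain A where A: "\<forall>a < q ^ n1. \<forall>b < q ^ n1. \<forall>c < q ^ n2. \<forall>d < q ^ n2.
    M $$ (a + q ^ n1 * c, b + q ^ n1 * d) = ?\<delta>1 a b * ?\<delta>2 c d
      * A (restrict (qudit q a) ?T1) (restrict (qudit q b) ?T1)
          (restrict (qudit q c) ?T2) (restrict (qudit q d) ?T2)"
    using acts_only_on_concat[OF assms] by blast
  show ?thesis
    unfolding acts_only_on_def id_entry_def[symmetric]
    \<comment> \<open>The witness is the sum left after removing the identity on the first
      block.\<close>
    by (rule exI[of _ "\<lambda>x y. \<Sum>c<q ^ n2. \<Sum>d<q ^ n2. cnj (v $ c)
        * (?\<delta>2 c d * A x y (restrict (qudit q c) ?T2) (restrict (qudit q d) ?T2)) * v' $ d"])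
       (simp add: contract_snd_def A sum_distrib_left, simp add: mult_ac)
qed

text \<open>The same argument with the blocks exchanged: the identity part on the second block is
  pulled out.\<close>

lemma acts_only_on_contract_fst:
  assumes "T \<subseteq> {..<n1 + n2}" "acts_only_on q (n1 + n2) T M"
  shows "acts_only_on q n2 {k. n1 + k \<in> T} (contract_fst (q ^ n1) (q ^ n2) u M u')"
proof -
  let ?T1 = "T \<inter> {..<n1}" and ?T2 = "{k. n1 + k \<in> T}"
  let ?\<delta>1 = "id_entry q ({..<n1} - ?T1)" and ?\<delta>2 = "id_entry q ({..<n2} - ?T2)"
  obtain A where A: "\<forall>a < q ^ n1. \<forall>b < q ^ n1. \<forall>c < q ^ n2. \<forall>d < q ^ n2.
    M $$ (a + q ^ n1 * c, b + q ^ n1 * d) = ?\<delta>1 a b * ?\<delta>2 c d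
      * A (restrict (qudit q a) ?T1) (restrict (qudit q b) ?T1)
          (restrict (qudit q c) ?T2) (restrict (qudit q d) ?T2)"
    using acts_only_on_concat[OF assms] by blast
  show ?thesis
    unfolding acts_only_on_def id_entry_def[symmetric]
    by (rule exI[of _ "\<lambda>x y. \<Sum>a<q ^ n1. \<Sum>b<q ^ n1. cnj (u $ a)
        * (?\<delta>1 a b * A (restrict (qudit q a) ?T1) (restrict (qudit q b) ?T1) x y) * u' $ b"])
       (simp add: contract_fst_def A sum_distrib_left, simp add: mult_ac)
qed

section \<open>The Knill-Laflamme conditions for product vectors\<close>

text \<open>Injectivity makes distinct product vectors the same as distinct pairs, so an
  off-diagonal matrix element is one in which some factor differs.\<close>

lemma knill_laflamme_tensor:
  assumes B: "B1 \<subseteq> carrier_vec (q ^ n1)" "B2 \<subseteq> carrier_vec (q ^ n2)"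
    and inj: "inj_on (\<lambda>(u, v). tensor_vec u v) (B1 \<times> B2)"
    and KL: "knill_laflamme q n1 d1 B1" "knill_laflamme q n2 d2 B2"
  shows "knill_laflamme q (n1 + n2) (min d1 d2) ((\<lambda>(u, v). tensor_vec u v) ` (B1 \<times> B2))"
proof -
  let ?B = "(\<lambda>(u, v). tensor_vec u v) ` (B1 \<times> B2)"
  have "?B \<subseteq> carrier_vec (q ^ (n1 + n2))"
    using B by (auto simp: power_add intro!: tensor_vec_carrier)
  then show ?thesis
  proof (subst knill_laflamme_iff, assumption, intro ballI allI impI)
    fix M T
    assume M: "M \<in> operators q (n1 + n2)" and T: "T \<subseteq> {..<n1 + n2}"
      and d: "card T < min d1 d2" and act: "acts_only_on q (n1 + n2) T M"
    have M': "M \<in> carrier_mat (q ^ n1 * q ^ n2) (q ^ n1 * q ^ n2)"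
      using M by (simp add: power_add)
    let ?T1 = "T \<inter> {..<n1}" and ?T2 = "{k. n1 + k \<in> T}"
    have "finite T" using T finite_subset by blast
    have "card ?T1 \<le> card T"
      by (intro card_mono \<open>finite T\<close>) auto
    moreover have "card ?T2 \<le> card T"
      \<comment> \<open>Adding \<open>n1\<close> embeds \<open>?T2\<close> into
        \<open>T\<close>.\<close>
      by (rule card_inj_on_le[of "(+) n1"]) (auto intro: \<open>finite T\<close>)
    ultimately have card: "card ?T1 < d1" "card ?T2 < d2"
      using d by auto
    have T12: "?T1 \<subseteq> {..<n1}" "?T2 \<subseteq> {..<n2}"
      using T by auto
    define e where "e u v u' v' = braket (tensor_vec u v) (M *\<^sub>v tensor_vec u' v')" for u v u' v'
    \<comment> \<open>The constant obtained here may still depend on \<open>v\<close> and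
      \<open>v'\<close>.\<close>
    have fst: "\<exists>c. \<forall>u \<in> B1. \<forall>u' \<in> B1. e u v u' v' = (if u = u' then c else 0)"
      if v: "v \<in> B2" "v' \<in> B2" for v v'
    proof -
      have "\<exists>c. \<forall>u \<in> B1. \<forall>u' \<in> B1.
          braket u (contract_snd (q ^ n1) (q ^ n2) v M v' *\<^sub>v u') = (if u = u' then c else 0)"
        by (rule KL(1)[unfolded knill_laflamme_iff[OF B(1)], rule_format,
              OF contract_carrier(1) T12(1) card(1) acts_only_on_contract_snd[OF T act]])
      moreover have "braket u (contract_snd (q ^ n1) (q ^ n2) v M v' *\<^sub>v u') = e u v u' v'"
        if "u \<in> B1" "u' \<in> B1" for u u'
        unfolding e_def using that v B by (intro braket_contract_snd M') auto
      ultimately show ?thesis by simp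
    qed
    have snd: "\<exists>c. \<forall>v \<in> B2. \<forall>v' \<in> B2. e u v u' v' = (if v = v' then c else 0)"
      if u: "u \<in> B1" "u' \<in> B1" for u u'
    proof -
      have "\<exists>c. \<forall>v \<in> B2. \<forall>v' \<in> B2.
          braket v (contract_fst (q ^ n1) (q ^ n2) u M u' *\<^sub>v v') = (if v = v' then c else 0)"
        by (rule KL(2)[unfolded knill_laflamme_iff[OF B(2)], rule_format,
              OF contract_carrier(2) T12(2) card(2) acts_only_on_contract_fst[OF T act]])
      moreover have "braket v (contract_fst (q ^ n1) (q ^ n2) u M u' *\<^sub>v v') = e u v u' v'"
        if "v \<in> B2" "v' \<in> B2" for v v'
        unfolding e_def using that u B by (intro braket_contract_fst M') auto
      ultimately show ?thesis by simp
    qed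
    \<comment> \<open>If \<open>u\<close> and \<open>u'\<close> differ, \<open>fst\<close> applies
      with \<open>v\<close> and \<open>v'\<close> fixed; otherwise \<open>snd\<close>
      applies.\<close>
    have off: "e u v u' v' = 0"
      if "u \<in> B1" "v \<in> B2" "u' \<in> B1" "v' \<in> B2" "u \<noteq> u' \<or> v \<noteq> v'" for u v u' v'
      using fst[OF that(2,4)] snd[OF that(1,3)] that by metis
    \<comment> \<open>One factor is changed at a time, passing through the pair \<open>u'\<close>,
      \<open>v\<close>.\<close>
    have diag: "e u v u v = e u' v' u' v'"
      if "u \<in> B1" "v \<in> B2" "u' \<in> B1" "v' \<in> B2" for u v u' v'
    proof -
      have "e u v u v = e u' v u' v"
        using fst[OF that(2,2)] that by metis
      also have "\<dots> = e u' v' u' v'"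
        using snd[OF that(3,3)] that by metis
      finally show ?thesis .
    qed
    show "\<exists>c. \<forall>w \<in> ?B. \<forall>w' \<in> ?B. braket w (M *\<^sub>v w') = (if w = w' then c else 0)"
    proof (cases "B1 \<times> B2 = {}")
      case False
      then obtain u0 v0 where uv0: "u0 \<in> B1" "v0 \<in> B2" by auto
      have "braket w (M *\<^sub>v w') = (if w = w' then e u0 v0 u0 v0 else 0)"
        if w: "w \<in> ?B" "w' \<in> ?B" for w w'
      proof -
        obtain u v u' v' where uv: "u \<in> B1" "v \<in> B2" "u' \<in> B1" "v' \<in> B2"
          and eq: "w = tensor_vec u v" "w' = tensor_vec u' v'"
          using w by auto
        have "w = w' \<longleftrightarrow> u = u' \<and> v = v'"
          using inj_on_eq_iff[OF inj, of "(u, v)" "(u', v')"] uv eq by auto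
        then show ?thesis
          using off[OF uv] diag[OF uv(1,2) uv0] by (auto simp: eq e_def)
      qed
      then show ?thesis by blast
    qed auto
  qed
qed

section \<open>Assembling the product code\<close>

theorem theorem4p2:
  fixes q n1 K1 d1 n2 K2 d2 :: nat
  assumes "q \<ge> 2"
    and "\<exists>C1. quantum_code q n1 K1 d1 C1"
    and "\<exists>C2. quantum_code q n2 K2 d2 C2"
  shows "\<exists>C'. quantum_code q (n1 + n2) (K1 * K2) (min d1 d2) C'"
proof -
  obtain C1 B1 where C1: "VectorSpace.subspace class_ring C1 (state_space q n1)"
    "vectorspace.dim class_ring (state_space q n1\<lparr>carrier := C1\<rparr>) = K1" "K1 > 1"
    and B1: "orthonormal_basis q n1 C1 B1" and KL1: "knill_laflamme q n1 d1 B1"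
    using assms(2) unfolding quantum_code_def by blast
  obtain C2 B2 where C2: "VectorSpace.subspace class_ring C2 (state_space q n2)"
    "vectorspace.dim class_ring (state_space q n2\<lparr>carrier := C2\<rparr>) = K2" "K2 > 1"
    and B2: "orthonormal_basis q n2 C2 B2" and KL2: "knill_laflamme q n2 d2 B2"
    using assms(3) unfolding quantum_code_def by blast
  note D1 = orthonormal_basisD[OF C1(1) B1] and D2 = orthonormal_basisD[OF C2(1) B2]
  define B where "B = (\<lambda>(u, v). tensor_vec u v) ` (B1 \<times> B2)"
  have braket: "braket (tensor_vec u v) (tensor_vec u' v') = (if u = u' \<and> v = v' then 1 else 0)"
    if "u \<in> B1" "v \<in> B2" "u' \<in> B1" "v' \<in> B2" for u v u' v'
  proof -
    have "braket (tensor_vec u v) (tensor_vec u' v') = braket u u' * braket v v'"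
      using that D1(1) D2(1) by (intro braket_tensor_vec) auto
    then show ?thesis
      using that B1 B2 by (auto simp: orthonormal_basis_def)
  qed
  \<comment> \<open>Equal product vectors from different pairs would have inner product both 0 and
    1.\<close>
  have inj: "inj_on (\<lambda>(u, v). tensor_vec u v) (B1 \<times> B2)"
  proof (rule inj_onI, clarify)
    fix u v u' v'
    assume uv: "u \<in> B1" "v \<in> B2" "u' \<in> B1" "v' \<in> B2"
      and eq: "tensor_vec u v = tensor_vec u' v'"
    have "(if u = u' \<and> v = v' then 1 else 0) = (1 :: complex)"
      using braket[OF uv] braket[OF uv(1,2) uv(1,2)] eq by simp
    then show "u = u' \<and> v = v'"
      by (simp split: if_splits)
  qed
  have "B \<subseteq> carrier_vec (q ^ (n1 + n2))"
    using D1(1) D2(1) by (auto simp: B_def power_add intro!: tensor_vec_carrier)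
  moreover have "finite B"
    using D1(2) D2(2) by (simp add: B_def)
  moreover have "\<forall>w \<in> B. \<forall>w' \<in> B. braket w w' = (if w = w' then 1 else 0)"
    unfolding B_def using braket inj by (auto simp: inj_on_def)
  ultimately obtain C where C: "VectorSpace.subspace class_ring C (state_space q (n1 + n2))"
    "orthonormal_basis q (n1 + n2) C B"
    using orthonormal_basis_span by blast
  \<comment> \<open>By injectivity the basis has as many elements as there are pairs.\<close>
  have "card B = K1 * K2"
    using D1(3) D2(3) C1(2) C2(2) by (simp add: B_def card_image[OF inj] card_cartesian_product)
  then have "vectorspace.dim class_ring (state_space q (n1 + n2)\<lparr>carrier := C\<rparr>) = K1 * K2"
    using orthonormal_basisD(3)[OF C] by simp
  moreover have "K1 * K2 > 1"
    using C1(3) C2(3) by (metis One_nat_def less_1_mult)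
  moreover have "knill_laflamme q (n1 + n2) (min d1 d2) B"
    unfolding B_def using D1(1) D2(1) inj KL1 KL2 by (rule knill_laflamme_tensor)
  ultimately show ?thesis
    unfolding quantum_code_def using C by blast
qed

end
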